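(* Let $a\in\mathbb{C}$ and let $n,j$ be integers with $1\le j\le n$. Then $$\sum_{k=j}^n\binom{n}{k}\binom{k}{j}\frac{(-1)^k a^k}{k}=\sum_{t=1}^n\frac{\binom{t}{j}(-a)^j(1-a)^{t-j}}{t}.$$
   Context: Conventions: $\binom{t}{j}=0$ for $0\le t<j$, and the corresponding terms of the right-hand sum are taken to be $0$; $0^0=1$. *)

theory Defs
  imports Complex_Main
begin

end

theory Submission
  imports Defs
begin

text \<open>
  Induction on \<open>n\<close>. By Pascal's rule and the absorption identity,
  \<open>(C(n+1,k) - C(n,k)) / k = C(n,k-1) / k = C(n+1,k) / (n+1)\<close>, so passing from \<open>n\<close> to \<open>n+1\<close> removes
  the factor \<open>1/k\<close> from the left-hand increment, which the binomial theorem then evaluates to the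
  term \<open>t = n+1\<close> on the right.
\<close>

text \<open>Trinomial revision, \<open>C(n,k) C(k,j) = C(n,j) C(n-j,k-j)\<close>, pulls
  \<open>C(n,j)\<close> out of the sum; after the shift \<open>k = i + j\<close> the binomial
  theorem applies.\<close>

lemma sum_choose_choose_power:
  fixes x :: "'a::comm_semiring_1"
  assumes "j \<le> n"
  shows "(\<Sum>k=j..n. of_nat (n choose k) * of_nat (k choose j) * x ^ k)
       = of_nat (n choose j) * x ^ j * (1 + x) ^ (n - j)"
proof -
  have "(\<Sum>k=j..n. of_nat (n choose k) * of_nat (k choose j) * x ^ k)
      = (\<Sum>k=j..n. of_nat (n choose j) * of_nat ((n - j) choose (k - j)) * x ^ k)"
    by (intro sum.cong refl) (simp add: choose_mult flip: of_nat_mult)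
  also have "\<dots> = (\<Sum>i\<le>n - j. of_nat (n choose j) * of_nat ((n - j) choose i) * x ^ (i + j))"
    using assms sum.shift_bounds_cl_nat_ivl
      [of "\<lambda>k. of_nat (n choose j) * of_nat ((n - j) choose (k - j)) * x ^ k" 0 j "n - j"]
    by (simp add: atLeast0AtMost)
  also have "\<dots> = of_nat (n choose j) * x ^ j * (\<Sum>i\<le>n - j. of_nat ((n - j) choose i) * x ^ i)"
    by (simp add: sum_distrib_left power_add mult_ac)
  also have "(\<Sum>i\<le>n - j. of_nat ((n - j) choose i) * x ^ i) = (1 + x) ^ (n - j)"
    using binomial_ring[of x 1 "n - j"] by (simp add: add.commute)
  finally show ?thesis .
qed

lemma choose_Suc_divide:
  assumes "1 \<le> k"
  shows "(of_nat (Suc n choose k) :: 'a::field_char_0) / of_nat k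
       = of_nat (n choose k) / of_nat k + of_nat (Suc n choose k) / of_nat (Suc n)"
proof -
  obtain i where k: "k = Suc i"
    using assms by (cases k) auto
  have "(of_nat (Suc n) :: 'a) * of_nat (n choose i) = of_nat (Suc n choose k) * of_nat k"
    unfolding k by (metis Suc_times_binomial_eq of_nat_mult)
  moreover have "(of_nat k :: 'a) \<noteq> 0" "(of_nat (Suc n) :: 'a) \<noteq> 0"
    unfolding k by (simp_all only: of_nat_eq_0_iff)
  ultimately have "(of_nat (n choose i) :: 'a) / of_nat k = of_nat (Suc n choose k) / of_nat (Suc n)"
    by (simp add: frac_eq_eq mult.commute del: of_nat_Suc)
  then show ?thesis
    unfolding k by (simp add: add_divide_distrib del: of_nat_Suc)
qed

text \<open>Without the bound \<open>j \<le> n\<close> the induction can start at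
  \<open>n = 0\<close>, where both sums are empty. Since \<open>1 \<le> j\<close>, every index
  \<open>k\<close> is nonzero, so the divisions by \<open>k\<close> are genuine.\<close>

lemma sum_choose_choose_power_divide:
  fixes x :: "'a::field_char_0"
  assumes "1 \<le> j"
  shows "(\<Sum>k=j..n. of_nat (n choose k) * of_nat (k choose j) * (x ^ k / of_nat k))
       = (\<Sum>t=1..n. of_nat (t choose j) * x ^ j * (1 + x) ^ (t - j) / of_nat t)"
proof (induction n)
  case 0
  then show ?case using assms by simp
next
  case (Suc n)
  show ?case
  proof (cases "j \<le> Suc n")
    case True
    let ?f = "\<lambda>m k. of_nat (m choose k) * of_nat (k choose j) * (x ^ k / of_nat k)"
    let ?g = "\<lambda>k. of_nat (Suc n choose k) * of_nat (k choose j) * x ^ k"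
    have step: "?f (Suc n) k = ?f n k + ?g k / of_nat (Suc n)" if "k \<in> {j..Suc n}" for k
    proof -
      have "?f (Suc n) k = of_nat (Suc n choose k) / of_nat k * (of_nat (k choose j) * x ^ k)"
        by simp
      also have "\<dots> = ?f n k + ?g k / of_nat (Suc n)"
        using that assms by (subst choose_Suc_divide) (simp_all add: algebra_simps del: of_nat_Suc)
      finally show ?thesis .
    qed
    have "(\<Sum>k=j..Suc n. ?f (Suc n) k) = (\<Sum>k=j..Suc n. ?f n k) + (\<Sum>k=j..Suc n. ?g k) / of_nat (Suc n)"
      using step by (simp only: sum.distrib sum_divide_distrib cong: sum.cong)
    \<comment> \<open>The extra index \<open>k = n+1\<close> contributes nothing because
      \<open>C(n,n+1) = 0\<close>.\<close>
    also have "(\<Sum>k=j..Suc n. ?f n k) = (\<Sum>k=j..n. ?f n k)"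
      using True by (simp add: binomial_eq_0)
    finally show ?thesis
      using Suc.IH sum_choose_choose_power[OF True, of x] by (simp del: of_nat_Suc binomial_Suc_Suc)
  next
    case False
    \<comment> \<open>For \<open>j > n+1\<close> the left sum is empty, and on the right every
      \<open>C(t,j)\<close> with \<open>t \<le> n+1\<close> vanishes.\<close>
    then show ?thesis by (simp add: binomial_eq_0)
  qed
qed

theorem mainTheorem2:
  fixes a :: complex and n j :: nat
  assumes "1 \<le> j" and "j \<le> n"
  shows "(\<Sum>k=j..n. of_nat (n choose k) * of_nat (k choose j) * ((-1) ^ k * a ^ k / of_nat k))
       = (\<Sum>t=1..n. of_nat (t choose j) * (-a) ^ j * (1 - a) ^ (t - j) / of_nat t)"
  \<comment> \<open>Taking \<open>x = -a\<close> turns \<open>1 + x\<close> into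
    \<open>1 - a\<close>; it remains to split \<open>(-a)^k\<close> as
    \<open>(-1)^k a^k\<close>.\<close>
  using sum_choose_choose_power_divide[OF assms(1), of n "- a"]
  by (simp add: power_minus[of a])

end
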